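(* In the simplex setting described in the context, with regret budget $U>0$, let $\tilde c=\max_{m\in[M]}c_m$, $$\tilde r=\frac1\sigma\sqrt{\frac{U^3}{8L^3K^3\,d\,M^{3/2}\left(\frac{2S}{\check\lambda}+\sqrt{4M-3}\right)^3}-R^2},$$ and let $a^*=[\alpha_1^*,\dots,\alpha_M^*]\in\mathbb{R}^M$ be the privacy vector with entries $$\alpha_m^*=\sqrt{\Big(\frac{R^2}{\sigma^2}+\tilde r^2\Big)\frac{c_m^2}{\tilde c^2}-\frac{R^2}{\sigma^2}},\qquad m\in[M],$$ where all quantities under square roots are assumed nonnegative, so that $a^*$ is a well-defined real vector. Then $a^*\in\mathcal{A}_*$, i.e. $a^*\in\mathcal{A}$ and $(a^*+\mathbb{R}_+^M)\cap\mathcal{A}=\{a^*\}$.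
   Context: Constants: integers $M,d\ge1$; reals $L,K,S,\nu,\check\lambda,\sigma>0$, $R\ge0$, $\delta'\in(0,1/2)$, and $c_1,\dots,c_M>0$. (In the paper they come from a safe and private linear bandit problem: $M$ agents with $d$-dimensional actions of norm at most $K$, bandit parameters of norm at most $S$, $R$-sub-Gaussian noise, $L$-Lipschitz objective, regularizer $\nu$, confidence $\delta'$, base standard deviation $\sigma$ of the Gaussian privacy noise, agent $m$ adding $\mathcal{N}(0,\alpha_m^2\sigma^2)$ noise to its response, and $\check\lambda$ the minimum eigenvalue of the covariance of the exploration actions.) $\mathbb{R}_+$ denotes the nonnegative reals. Privacy vector: $a=[\alpha_1,\dots,\alpha_M]\in\mathbb{R}_+^M$. Confidence radii: $$\beta_{T,m}=\sqrt{R^2+\alpha_m^2\sigma^2}\,\sqrt{d\log\Big(\frac{1+TK^2/\nu}{\delta'/M}\Big)}+S\sqrt\nu,\qquad \tilde\beta_T=\max_{m\in[M]}\beta_{T,m}.$$ Safe set: the simplex $\mathcal{S}=\{x\in\mathbb{R}^M:\sum_{m=1}^M x_m/c_m\le\frac12,\ -x_m\le\frac1{2q}\ \forall m\in[M]\}$ with $q=\sum_{m=1}^M1/c_m$. Its scaled version is $\mathcal{S}'=\{\mathbf{B}x:x\in\mathcal{S}\}$ with $\mathbf{B}=\mathrm{diag}(1/\beta_{T,1},\dots,1/\beta_{T,M})$. Geometry: for a compact $\mathcal{Z}\subset\mathbb{R}^M$ and $\Delta\ge0$, $\mathcal{Z}^{\infty}_{\Delta}=\{x\in\mathcal{Z}:x+v\in\mathcal{Z}\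 \forall v\text{ with }\|v\|_\infty\le\Delta\}$; $\mathcal{H}^{\infty}_{\mathcal{Z}}=\sup\{\Delta:\mathcal{Z}^{\infty}_\Delta\ne\emptyset\}$; $\mathrm{Sharp}^{\infty}_{\mathcal{Z}}(\Delta)=\sup_{x\in\mathcal{Z}}\inf_{y\in\mathcal{Z}^{\infty}_\Delta}\|y-x\|_2$ whenever $\mathcal{Z}^\infty_\Delta\ne\emptyset$. Regret bound as a function of the privacy vector: $$r(T,a)=2LKS\sqrt M\,T'+L\tilde\beta_T(T-T')\,\mathrm{Sharp}^{\infty}_{\mathcal{S}'}\!\left(\frac{2\sqrt2K}{\sqrt{2\nu+\check\lambda T'}}\right)+L\max(\mathcal{H}^{\infty}_{\mathcal{S}'},2)\sqrt{2d\log\Big(1+\frac{TK^2}{d\nu}\Big)(T-T')\sum_{m=1}^M\beta_{T,m}^2},$$ where $T'=\max\big(t'_h,\,t_{\delta'},\,\frac{2}{\check\lambda}(\tilde\beta_TT)^{2/3}\big)$, $t_{\delta'}=\frac{8K^2}{\check\lambda}\log\frac d{\delta'}$, $t'_h=\frac{8K^2}{\check\lambda(\mathcal{H}^\infty_{\mathcal{S}'})^2}-\frac{2\nu}{\check\lambda}$ ($T'$ is treated as a real number). Asymptotic constant: $r(a)=\lim_{T\to\infty}\dfrac{r(T,a)}{(T^2\log T)^{1/3}}$. Allowable privacy vectors: $\mathcal{A}=\{a\in\mathbb{R}_+^M:r(a)\le U\}$. Unilaterally unimprovable vectors: $\mathcal{A}_*=\{a\in\mathcal{A}:(a+\mathbb{R}_+^M)\cap\mathcal{A}=\{a\}\}$.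 *)

theory Defs
  imports "HOL-Analysis.Analysis"
begin

text \<open>
  The agents are indexed by a finite type \<open>'m\<close>, so \<open>M = CARD('m)\<close>, and privacy vectors are
  elements of \<open>real ^ 'm\<close>. Throughout, \<open>lam\<close> is the minimum eigenvalue of the covariance of the
  exploration actions and \<open>\<delta>\<close> is the confidence parameter.
\<close>

definition beta :: "real \<Rightarrow> real \<Rightarrow> real \<Rightarrow> real \<Rightarrow> real \<Rightarrow> real \<Rightarrow> nat \<Rightarrow> nat \<Rightarrow> real ^ 'm \<Rightarrow> 'm \<Rightarrow> real"
  where "beta K S \<nu> \<sigma> R \<delta> d T a m =
    sqrt (R\<^sup>2 + (a $ m)\<^sup>2 * \<sigma>\<^sup>2) *
    sqrt (real d * ln ((1 + real T * K\<^sup>2 / \<nu>) / (\<delta> / real CARD('m)))) + S * sqrt \<nu>"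

definition beta_max :: "real \<Rightarrow> real \<Rightarrow> real \<Rightarrow> real \<Rightarrow> real \<Rightarrow> real \<Rightarrow> nat \<Rightarrow> nat \<Rightarrow> real ^ 'm \<Rightarrow> real"
  where "beta_max K S \<nu> \<sigma> R \<delta> d T a = Max (range (beta K S \<nu> \<sigma> R \<delta> d T a))"

definition safe_simplex :: "real ^ 'm \<Rightarrow> (real ^ 'm) set"
  where "safe_simplex c =
    {x. (\<Sum>m\<in>UNIV. x $ m / c $ m) \<le> 1 / 2 \<and>
        (\<forall>m. - (x $ m) \<le> 1 / (2 * (\<Sum>m\<in>UNIV. 1 / c $ m)))}"

definition diag_mat :: "('m \<Rightarrow> real) \<Rightarrow> real ^ 'm ^ 'm"
  where "diag_mat b = (\<chi> i j. if i = j then b i else 0)"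

definition scaled_simplex ::
    "real \<Rightarrow> real \<Rightarrow> real \<Rightarrow> real \<Rightarrow> real \<Rightarrow> real \<Rightarrow> nat \<Rightarrow> real ^ 'm \<Rightarrow> nat \<Rightarrow> real ^ 'm \<Rightarrow> (real ^ 'm) set"
  where "scaled_simplex K S \<nu> \<sigma> R \<delta> d c T a =
    (\<lambda>x. diag_mat (\<lambda>m. 1 / beta K S \<nu> \<sigma> R \<delta> d T a m) *v x) ` safe_simplex c"

definition shrunk :: "(real ^ 'm) set \<Rightarrow> real \<Rightarrow> (real ^ 'm) set"
  where "shrunk Z \<Delta> = {x \<in> Z. \<forall>v. infnorm v \<le> \<Delta> \<longrightarrow> x + v \<in> Z}"

definition max_shrinkage :: "(real ^ 'm) set \<Rightarrow> real"
  where "max_shrinkage Z = Sup {\<Delta>. 0 \<le> \<Delta> \<and> shrunk Z \<Delta> \<noteq> {}}"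

text \<open>Meaningful for compact \<open>Z\<close> with \<open>shrunk Z \<Delta> \<noteq> {}\<close>, where supremum and infimum are over
  nonempty bounded sets of reals. The lower bound \<open>t_h\<close> on the exploration time below
  guarantees this at the point where \<open>regret_bound\<close> evaluates it.\<close>

definition sharpness :: "(real ^ 'm) set \<Rightarrow> real \<Rightarrow> real"
  where "sharpness Z \<Delta> = (SUP x\<in>Z. INF y\<in>shrunk Z \<Delta>. norm (y - x))"

definition t_h ::
    "real \<Rightarrow> real \<Rightarrow> real \<Rightarrow> real \<Rightarrow> real \<Rightarrow> real \<Rightarrow> real \<Rightarrow> nat \<Rightarrow> real ^ 'm \<Rightarrow> nat \<Rightarrow> real ^ 'm \<Rightarrow> real"
  where "t_h K S \<nu> lam \<sigma> R \<delta> d c T a =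
    8 * K\<^sup>2 / (lam * (max_shrinkage (scaled_simplex K S \<nu> \<sigma> R \<delta> d c T a))\<^sup>2) - 2 * \<nu> / lam"

definition t_delta :: "real \<Rightarrow> real \<Rightarrow> real \<Rightarrow> nat \<Rightarrow> real"
  where "t_delta K lam \<delta> d = 8 * K\<^sup>2 / lam * ln (real d / \<delta>)"

definition exploration_time ::
    "real \<Rightarrow> real \<Rightarrow> real \<Rightarrow> real \<Rightarrow> real \<Rightarrow> real \<Rightarrow> real \<Rightarrow> nat \<Rightarrow> real ^ 'm \<Rightarrow> nat \<Rightarrow> real ^ 'm \<Rightarrow> real"
  where "exploration_time K S \<nu> lam \<sigma> R \<delta> d c T a =
    max (t_h K S \<nu> lam \<sigma> R \<delta> d c T a)
      (max (t_delta K lam \<delta> d)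
        (2 / lam * (beta_max K S \<nu> \<sigma> R \<delta> d T a * real T) powr (2 / 3)))"

definition regret_bound ::
    "real \<Rightarrow> real \<Rightarrow> real \<Rightarrow> real \<Rightarrow> real \<Rightarrow> real \<Rightarrow> real \<Rightarrow> real \<Rightarrow> nat \<Rightarrow> real ^ 'm \<Rightarrow> nat \<Rightarrow> real ^ 'm \<Rightarrow> real"
  where "regret_bound L K S \<nu> lam \<sigma> R \<delta> d c T a =
    (let T' = exploration_time K S \<nu> lam \<sigma> R \<delta> d c T a;
         Z = scaled_simplex K S \<nu> \<sigma> R \<delta> d c T a
     in 2 * L * K * S * sqrt (real CARD('m)) * T'
        + L * beta_max K S \<nu> \<sigma> R \<delta> d T a * (real T - T') *
            sharpness Z (2 * sqrt 2 * K / sqrt (2 * \<nu> + lam * T'))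
        + L * max (max_shrinkage Z) 2 *
            sqrt (2 * real d * ln (1 + real T * K\<^sup>2 / (real d * \<nu>)) * (real T - T') *
                  (\<Sum>m\<in>UNIV. (beta K S \<nu> \<sigma> R \<delta> d T a m)\<^sup>2)))"

text \<open>The limit is taken in the extended reals: it is \<open>\<infinity>\<close> when \<open>R = 0\<close> and some, but not all,
  entries of \<open>a\<close> vanish, and finite for every other nonnegative \<open>a\<close>.\<close>

definition regret_const ::
    "real \<Rightarrow> real \<Rightarrow> real \<Rightarrow> real \<Rightarrow> real \<Rightarrow> real \<Rightarrow> real \<Rightarrow> real \<Rightarrow> nat \<Rightarrow> real ^ 'm \<Rightarrow> real ^ 'm \<Rightarrow> ereal"
  where "regret_const L K S \<nu> lam \<sigma> R \<delta> d c a =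
    lim (\<lambda>T::nat. ereal (regret_bound L K S \<nu> lam \<sigma> R \<delta> d c T a /
                         ((real T)\<^sup>2 * ln (real T)) powr (1 / 3)))"

definition allowable ::
    "real \<Rightarrow> real \<Rightarrow> real \<Rightarrow> real \<Rightarrow> real \<Rightarrow> real \<Rightarrow> real \<Rightarrow> real \<Rightarrow> nat \<Rightarrow> real ^ 'm \<Rightarrow> real \<Rightarrow> (real ^ 'm) set"
  where "allowable L K S \<nu> lam \<sigma> R \<delta> d c U =
    {a. (\<forall>m. 0 \<le> a $ m) \<and> regret_const L K S \<nu> lam \<sigma> R \<delta> d c a \<le> ereal U}"

definition unimprovable ::
    "real \<Rightarrow> real \<Rightarrow> real \<Rightarrow> real \<Rightarrow> real \<Rightarrow> real \<Rightarrow> real \<Rightarrow> real \<Rightarrow> nat \<Rightarrow> real ^ 'm \<Rightarrow> real \<Rightarrow> (real ^ 'm) set"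
  where "unimprovable L K S \<nu> lam \<sigma> R \<delta> d c U =
    {a \<in> allowable L K S \<nu> lam \<sigma> R \<delta> d c U.
       {a + v | v. \<forall>m. 0 \<le> v $ m} \<inter> allowable L K S \<nu> lam \<sigma> R \<delta> d c U = {a}}"

end

theory Submission
  imports Defs "HOL-Real_Asymp.Real_Asymp"
begin

text \<open>
  Put \<open>w\<^sub>m = \<beta>\<^sub>m / c\<^sub>m\<close>, \<open>W = \<Sum> w\<^sub>m\<close> and \<open>g\<^sub>m = sqrt (R\<^sup>2 + \<alpha>\<^sub>m\<^sup>2 \<sigma>\<^sup>2)\<close>. The scaled safe set is a translate of
  the corner simplex \<open>{u \<ge> 0. \<Sum> w\<^sub>m u\<^sub>m \<le> 1}\<close>, so its shrinkage is explicit: the maximal one is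
  \<open>1 / (2 W)\<close>, and the sharpness is exactly \<open>\<Delta> \<kappa>(w)\<close> with
  \<open>\<kappa>(w) = sqrt (M - 1 + (2 W / min w - 1)\<^sup>2)\<close>. As \<open>\<beta>\<^sub>m\<close> grows like \<open>g\<^sub>m sqrt (d ln T)\<close> and \<open>\<kappa>\<close> is invariant
  under scaling, the asymptotic constant is
  \<open>2 L K (max g * sqrt d) powr (2/3) * (2 S sqrt M / \<lambda> + \<kappa>(g / c))\<close> whenever all \<open>g\<^sub>m\<close> are positive,
  which holds at and above \<open>a\<^sup>*\<close>. The factor \<open>\<kappa>(g / c)\<close> is minimal, with value
  \<open>sqrt (M (4 M - 3))\<close>, precisely when \<open>g\<close> is proportional to \<open>c\<close>. This is the case at \<open>a\<^sup>*\<close>, where the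
  constant equals \<open>U\<close>. An allowable vector above \<open>a\<^sup>*\<close> can increase neither \<open>max g\<close> nor \<open>\<kappa>\<close>, so its
  \<open>g\<close> is proportional to \<open>c\<close> with the same maximum, hence unchanged.
\<close>

section \<open>Shape of the scaled safe set and its maximal shrinkage\<close>

definition corner_simplex :: "('m \<Rightarrow> real) \<Rightarrow> ('m \<Rightarrow> real) \<Rightarrow> (real ^ 'm) set"
  where "corner_simplex p w = {y. (\<forall>m. p m \<le> y $ m) \<and> (\<Sum>m\<in>UNIV. w m * (y $ m - p m)) \<le> 1}"

text \<open>Shrinking by \<Delta> moves the vertex on the axis of least weight by \<Delta> in M - 1
  coordinates and by \<open>(2 * W / min w - 1) * \<Delta>\<close> in the remaining one; this is the
  length of that move in units of \<Delta>.\<close>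

definition sharp_const :: "('m::finite \<Rightarrow> real) \<Rightarrow> real"
  where "sharp_const w = sqrt (real CARD('m) - 1 + (2 * sum w UNIV / Min (range w) - 1)\<^sup>2)"

text \<open>With x = b y the lower bounds meet at the corner with entries
  \<open>- 1 / (2 * q * b m)\<close>. Measuring the weighted sum from there adds q / (2 q) = 1/2, so
  the bound 1/2 becomes 1.\<close>

lemma scaled_simplex_eq_corner_simplex:
  fixes c a :: "real ^ 'm"
  assumes c: "\<And>m. c $ m > 0" and b: "\<And>m. beta K S \<nu> \<sigma> R \<delta> d T a m > 0"
  shows "scaled_simplex K S \<nu> \<sigma> R \<delta> d c T a =
    corner_simplex (\<lambda>m. - (1 / (2 * (\<Sum>m\<in>UNIV. 1 / c $ m) * beta K S \<nu> \<sigma> R \<delta> d T a m)))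
      (\<lambda>m. beta K S \<nu> \<sigma> R \<delta> d T a m / c $ m)"
proof -
  define b where "b = beta K S \<nu> \<sigma> R \<delta> d T a"
  define q where "q = (\<Sum>m\<in>UNIV. 1 / c $ m)"
  have b0: "b m > 0" for m using b by (simp add: b_def)
  have q: "q > 0" unfolding q_def using c by (intro sum_pos) auto
  have D: "(diag_mat (\<lambda>m. 1 / b m) *v x) $ m = x $ m / b m" for x :: "real ^ 'm" and m
    by (simp add: diag_mat_def matrix_vector_mult_def if_distrib if_distribR sum.delta cong: if_cong)
  have sums: "(\<Sum>m\<in>UNIV. b m / c $ m * (y $ m - - (1 / (2 * q * b m)))) =
      (\<Sum>m\<in>UNIV. b m * y $ m / c $ m) + 1 / 2" for y :: "real ^ 'm"
  proof -
    have "b m / c $ m * (y $ m - - (1 / (2 * q * b m))) = b m * y $ m / c $ m + (1 / c $ m) / (2 * q)" for m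
      using b0[of m] c[of m] q by (simp add: field_simps)
    then have "(\<Sum>m\<in>UNIV. b m / c $ m * (y $ m - - (1 / (2 * q * b m)))) =
      (\<Sum>m\<in>UNIV. b m * y $ m / c $ m) + q / (2 * q)"
      by (simp add: sum.distrib q_def sum_divide_distrib)
    then show ?thesis using q by simp
  qed
  have lower: "- (1 / (2 * q * b m)) \<le> y $ m \<longleftrightarrow> - (b m * y $ m) \<le> 1 / (2 * q)" for y :: "real ^ 'm" and m
  proof -
    have "- (1 / (2 * q * b m)) \<le> y $ m \<longleftrightarrow> b m * - (1 / (2 * q * b m)) \<le> b m * y $ m"
      using b0[of m] by (simp only: mult_le_cancel_left_pos)
    also have "b m * - (1 / (2 * q * b m)) = - (1 / (2 * q))" using b0[of m] by simp
    finally show ?thesis by linarith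
  qed
  have "(\<lambda>x. diag_mat (\<lambda>m. 1 / b m) *v x) ` safe_simplex c =
    corner_simplex (\<lambda>m. - (1 / (2 * q * b m))) (\<lambda>m. b m / c $ m)" (is "?f ` _ = ?C")
  proof (intro equalityI subsetI)
    fix y assume "y \<in> ?f ` safe_simplex c"
    then obtain x where x: "x \<in> safe_simplex c" and y: "y = ?f x" by auto
    have "b m * y $ m = x $ m" for m using b0[of m] by (simp add: y D)
    then show "y \<in> ?C"
      using x unfolding corner_simplex_def safe_simplex_def mem_Collect_eq sums lower q_def[symmetric] by simp
  next
    fix y assume y: "y \<in> ?C"
    have "y = ?f (\<chi> m. b m * y $ m)" using b0 by (simp add: vec_eq_iff D less_imp_neq[symmetric])
    moreover have "(\<chi> m. b m * y $ m) \<in> safe_simplex c"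
      using y unfolding corner_simplex_def safe_simplex_def mem_Collect_eq sums lower q_def[symmetric] by simp
    ultimately show "y \<in> ?f ` safe_simplex c" by blast
  qed
  then show ?thesis by (simp add: scaled_simplex_def b_def q_def)
qed

text \<open>Among shifts in the box of radius \<Delta>, the constant one \<open>- \<Delta>\<close>
  is worst for all lower bounds and the constant one \<Delta> is worst for the sum, as the weights
  are positive. These two shifts decide membership.\<close>

lemma shrunk_corner_simplex:
  fixes w p :: "'m::finite \<Rightarrow> real"
  assumes w: "\<And>m. w m > 0" and D: "0 \<le> \<Delta>"
  shows "shrunk (corner_simplex p w) \<Delta> =
    {y. (\<forall>m. p m + \<Delta> \<le> y $ m) \<and> (\<Sum>m\<in>UNIV. w m * (y $ m - p m)) + \<Delta> * sum w UNIV \<le> 1}"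
    (is "_ = ?S")
proof (intro equalityI subsetI)
  fix y assume y: "y \<in> shrunk (corner_simplex p w) \<Delta>"
  have v: "infnorm (vec t :: real ^ 'm) \<le> \<Delta>" if "\<bar>t\<bar> = \<Delta>" for t
    using that by (simp add: infnorm_cart)
  have "y + vec \<Delta> \<in> corner_simplex p w" "y + vec (- \<Delta>) \<in> corner_simplex p w"
    using y v[of \<Delta>] v[of "- \<Delta>"] D by (auto simp: shrunk_def)
  then have "(\<Sum>m\<in>UNIV. w m * (y $ m + \<Delta> - p m)) \<le> 1" and l: "p m + \<Delta> \<le> y $ m" for m
    by (auto simp: corner_simplex_def le_diff_eq)
  moreover have "(\<Sum>m\<in>UNIV. w m * (y $ m + \<Delta> - p m)) = (\<Sum>m\<in>UNIV. w m * (y $ m - p m)) + \<Delta> * sum w UNIV"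
    by (simp add: sum_distrib_left flip: sum.distrib) (simp add: algebra_simps)
  ultimately show "y \<in> ?S" by simp
next
  fix y assume y: "y \<in> ?S"
  have "y + v \<in> corner_simplex p w" if "infnorm v \<le> \<Delta>" for v
  proof -
    have v: "\<bar>v $ m\<bar> \<le> \<Delta>" for m using that component_le_infnorm_cart[of v m] by linarith
    have "(\<Sum>m\<in>UNIV. w m * ((y + v) $ m - p m)) \<le> (\<Sum>m\<in>UNIV. w m * (y $ m - p m) + w m * \<Delta>)"
      using v w by (intro sum_mono) (simp add: abs_le_iff less_imp_le flip: distrib_left)
    also have "\<dots> \<le> 1" using y by (simp add: sum.distrib sum_distrib_left mult.commute)
    finally have "(\<Sum>m\<in>UNIV. w m * ((y + v) $ m - p m)) \<le> 1" .
    moreover have "p m \<le> (y + v) $ m" for m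
    proof -
      have "p m + \<Delta> \<le> y $ m" using y by simp
      then show ?thesis using v[of m] by (simp add: abs_le_iff)
    qed
    ultimately show ?thesis by (simp add: corner_simplex_def)
  qed
  note shift = this
  have "y \<in> corner_simplex p w" using shift[of 0] D by (simp add: infnorm_0)
  then show "y \<in> shrunk (corner_simplex p w) \<Delta>" using shift by (simp add: shrunk_def)
qed

text \<open>The cheapest candidate is the corner raised by \<Delta> in every coordinate: it uses
  \<Delta> W of the budget, and the box around it needs another \<Delta> W.\<close>

lemma shrunk_corner_simplex_nonempty_iff:
  fixes w p :: "'m::finite \<Rightarrow> real"
  assumes w: "\<And>m. w m > 0" and D: "0 \<le> \<Delta>"
  shows "shrunk (corner_simplex p w) \<Delta> \<noteq> {} \<longleftrightarrow> \<Delta> \<le> 1 / (2 * sum w UNIV)"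
proof -
  have W: "sum w UNIV > 0" using w by (intro sum_pos) auto
  have le: "\<Delta> \<le> 1 / (2 * sum w UNIV) \<longleftrightarrow> 2 * \<Delta> * sum w UNIV \<le> 1"
    using W by (simp add: field_simps)
  show ?thesis
  proof
    assume "shrunk (corner_simplex p w) \<Delta> \<noteq> {}"
    then obtain y where y: "\<And>m. p m + \<Delta> \<le> y $ m"
      "(\<Sum>m\<in>UNIV. w m * (y $ m - p m)) + \<Delta> * sum w UNIV \<le> 1"
      unfolding shrunk_corner_simplex[OF assms] by blast
    have "\<Delta> * sum w UNIV \<le> (\<Sum>m\<in>UNIV. w m * (y $ m - p m))"
      unfolding sum_distrib_left using y(1) w
      by (intro sum_mono) (simp add: mult.commute[of \<Delta>] le_diff_eq less_imp_le add.commute)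
    then show "\<Delta> \<le> 1 / (2 * sum w UNIV)" using y(2) le by simp
  next
    assume "\<Delta> \<le> 1 / (2 * sum w UNIV)"
    then have "(\<chi> m. p m + \<Delta>) \<in> shrunk (corner_simplex p w) \<Delta>"
      unfolding shrunk_corner_simplex[OF assms] le by (simp add: mult.commute[of _ \<Delta>] flip: sum_distrib_left)
    then show "shrunk (corner_simplex p w) \<Delta> \<noteq> {}" by blast
  qed
qed

lemma max_shrinkage_corner_simplex:
  fixes w p :: "'m::finite \<Rightarrow> real"
  assumes w: "\<And>m. w m > 0"
  shows "max_shrinkage (corner_simplex p w) = 1 / (2 * sum w UNIV)"
proof -
  have W: "sum w UNIV > 0" using w by (intro sum_pos) auto
  have "{\<Delta>. 0 \<le> \<Delta> \<and> shrunk (corner_simplex p w) \<Delta> \<noteq> {}} = {0..1 / (2 * sum w UNIV)}"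
    by (intro set_eqI) (simp add: shrunk_corner_simplex_nonempty_iff[OF w] cong: conj_cong)
  then show ?thesis using W by (simp add: max_shrinkage_def)
qed

section \<open>Sharpness of the corner simplex\<close>

lemma Min_range_pos:
  fixes w :: "'m::finite \<Rightarrow> real"
  assumes "\<And>m. w m > 0"
  shows "Min (range w) > 0"
  using assms by simp

lemma Min_range_le_sum:
  fixes w :: "'m::finite \<Rightarrow> real"
  assumes w: "\<And>m. w m > 0"
  shows "Min (range w) \<le> sum w UNIV"
proof -
  \<comment> \<open>Index types are inhabited, and any index will do: its weight lies between the
    minimum and the sum.\<close>
  fix k :: 'm
  have "Min (range w) \<le> w k" by simp
  also have "\<dots> \<le> sum w UNIV" using w by (intro member_le_sum) (auto intro: less_imp_le)
  finally show ?thesis .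
qed

lemma sum_power2_le_power2_sum:
  fixes u :: "'m \<Rightarrow> real"
  assumes "finite A" and "\<And>m. m \<in> A \<Longrightarrow> u m \<ge> 0"
  shows "(\<Sum>m\<in>A. (u m)\<^sup>2) \<le> (sum u A)\<^sup>2"
proof -
  have "(\<Sum>m\<in>A. (u m)\<^sup>2) \<le> (\<Sum>m\<in>A. u m * sum u A)"
    unfolding power2_eq_square using assms by (intro sum_mono mult_left_mono member_le_sum) auto
  also have "\<dots> = (sum u A)\<^sup>2" by (simp add: power2_eq_square flip: sum_distrib_right)
  finally show ?thesis .
qed

lemma norm_vec_power2: "(norm x)\<^sup>2 = (\<Sum>m\<in>UNIV. (x $ m)\<^sup>2)" for x :: "real ^ 'm"
  by (simp add: norm_vec_def L2_set_def sum_nonneg)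

text \<open>The shrunk simplex is a homothetic copy of the simplex, and the image of a point under the
  homothety is close enough to it. The bound is attained at the vertex on the axis with the
  smallest weight.\<close>

lemma sharpness_corner_simplex:
  fixes w p :: "'m::finite \<Rightarrow> real"
  assumes w: "\<And>m. w m > 0" and D: "0 \<le> \<Delta>" and D': "\<Delta> \<le> 1 / (2 * sum w UNIV)"
  shows "sharpness (corner_simplex p w) \<Delta> = \<Delta> * sharp_const w"
proof -
  let ?W = "sum w UNIV" and ?Z = "corner_simplex p w" and ?M = "real CARD('m)"
  have W: "?W > 0" using w by (intro sum_pos) auto
  have DW: "2 * \<Delta> * ?W \<le> 1" using D' W by (simp add: field_simps)
  have ne: "shrunk ?Z \<Delta> \<noteq> {}" using shrunk_corner_simplex_nonempty_iff[OF w D, where p = p] D' by simp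
  note sh = shrunk_corner_simplex[OF w D, where p = p]
  \<comment> \<open>The longest leg of the simplex, on an axis of least weight.\<close>
  define r where "r = 1 / Min (range w)"
  have r: "r > 0" "1 \<le> ?W * r"
    using Min_range_pos[of w, OF w] Min_range_le_sum[of w, OF w] by (simp_all add: r_def)
  have sc: "sharp_const w = sqrt (?M - 1 + (2 * ?W * r - 1)\<^sup>2)" by (simp add: sharp_const_def r_def)
  have bdd: "bdd_below ((\<lambda>y. norm (y - x)) ` shrunk ?Z \<Delta>)" for x
    by (intro bdd_belowI2[of _ 0]) simp
  have M: "?M \<ge> 1" by (simp add: Suc_leI)
  have upper: "(INF y\<in>shrunk ?Z \<Delta>. norm (y - x)) \<le> \<Delta> * sharp_const w" if x: "x \<in> ?Z" for x
  proof -
    define u where "u = (\<lambda>m. x $ m - p m)"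
    have u: "u m \<ge> 0" for m using x by (simp add: corner_simplex_def u_def)
    have wu: "(\<Sum>m\<in>UNIV. w m * u m) \<le> 1" using x by (simp add: corner_simplex_def u_def)
    define s where "s = sum u UNIV"
    have s0: "s \<ge> 0" by (simp add: s_def sum_nonneg u)
    have "Min (range w) * s \<le> (\<Sum>m\<in>UNIV. w m * u m)"
      unfolding s_def sum_distrib_left by (intro sum_mono mult_right_mono u) simp
    then have sr: "s \<le> r" using wu Min_range_pos[of w, OF w] by (simp add: r_def field_simps)
    \<comment> \<open>Image of \<open>x\<close> under the homothety onto the shrunk simplex: the
      corner rises by \<Delta> in each coordinate and the legs keep the fraction
      \<open>1 - 2 * \<Delta> * W\<close>.\<close>
    define y where "y = (\<chi> m. p m + \<Delta> + (1 - 2 * \<Delta> * ?W) * u m)"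
    have "(\<Sum>m\<in>UNIV. w m * (y $ m - p m)) + \<Delta> * ?W = (\<Sum>m\<in>UNIV. w m * \<Delta> + (1 - 2 * \<Delta> * ?W) * (w m * u m)) + \<Delta> * ?W"
      by (simp add: y_def algebra_simps)
    also have "\<dots> = 2 * \<Delta> * ?W + (1 - 2 * \<Delta> * ?W) * (\<Sum>m\<in>UNIV. w m * u m)"
      by (simp add: sum.distrib flip: sum_distrib_left sum_distrib_right)
    also have "\<dots> \<le> 2 * \<Delta> * ?W + (1 - 2 * \<Delta> * ?W) * 1"
      by (intro add_left_mono mult_left_mono wu) (use DW in simp)
    finally have y: "y \<in> shrunk ?Z \<Delta>"
      unfolding sh using u DW by (simp add: y_def)
    have "(norm (y - x))\<^sup>2 = (\<Sum>m\<in>UNIV. \<Delta>\<^sup>2 * (1 - 4 * ?W * u m + 4 * ?W\<^sup>2 * (u m)\<^sup>2))"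
      unfolding norm_vec_power2
    proof (intro sum.cong refl)
      fix m
      have yx: "(y - x) $ m = \<Delta> * (1 - 2 * ?W * u m)" by (simp add: y_def u_def algebra_simps)
      show "((y - x) $ m)\<^sup>2 = \<Delta>\<^sup>2 * (1 - 4 * ?W * u m + 4 * ?W\<^sup>2 * (u m)\<^sup>2)"
        unfolding yx by (simp add: power2_eq_square algebra_simps)
    qed
    also have "\<dots> = \<Delta>\<^sup>2 * (?M - 4 * ?W * s + 4 * ?W\<^sup>2 * (\<Sum>m\<in>UNIV. (u m)\<^sup>2))"
      by (simp add: s_def sum.distrib sum_subtractf flip: sum_distrib_left)
    \<comment> \<open>The bound now depends on the coordinate sum \<open>s\<close> only. Nothing is
      lost at points with a single nonzero coordinate, such as the vertices.\<close>
    also have "\<dots> \<le> \<Delta>\<^sup>2 * (?M - 4 * ?W * s + 4 * ?W\<^sup>2 * s\<^sup>2)"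
      using sum_power2_le_power2_sum[of UNIV u] u
      by (intro mult_left_mono add_left_mono) (simp_all add: s_def)
    also have "\<dots> = \<Delta>\<^sup>2 * (?M - 1 + (2 * ?W * s - 1)\<^sup>2)" by (simp add: power2_eq_square algebra_simps)
    also have "\<dots> \<le> \<Delta>\<^sup>2 * (?M - 1 + (2 * ?W * r - 1)\<^sup>2)"
    proof (intro mult_left_mono add_left_mono)
      \<comment> \<open>The parabola is not monotone from 0 on, but \<open>W * r \<ge> 1\<close>
        makes its value at \<open>r\<close> at least those at both ends 0 and
        \<open>r\<close>.\<close>
      have "?W * s \<le> ?W * r" "0 \<le> ?W * s" using sr W s0 by simp_all
      then have "\<bar>2 * ?W * s - 1\<bar> \<le> \<bar>2 * ?W * r - 1\<bar>" using r by linarith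
      then show "(2 * ?W * s - 1)\<^sup>2 \<le> (2 * ?W * r - 1)\<^sup>2" by (simp only: abs_le_square_iff)
    qed simp
    also have "\<dots> = (\<Delta> * sharp_const w)\<^sup>2" using M by (simp add: sc power_mult_distrib)
    finally have "norm (y - x) \<le> \<Delta> * sharp_const w"
      by (rule power2_le_imp_le) (use D M in \<open>simp add: sc\<close>)
    then show ?thesis by (intro cINF_lower2[OF bdd y])
  qed
  obtain k where k: "w k = Min (range w)" using Min_in[of "range w"] by fastforce
  then have rk: "r = 1 / w k" by (simp add: r_def)
  \<comment> \<open>The extremal vertex: the corner moved by the full leg along axis
    \<open>k\<close>.\<close>
  define x where "x = (\<chi> m. p m + (if m = k then r else 0))"
  have "w m * (x $ m - p m) = (if m = k then w m * r else 0)" for m by (simp add: x_def)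
  then have x: "x \<in> ?Z" using r w[of k] by (simp add: corner_simplex_def x_def rk)
  have "\<Delta> * sharp_const w \<le> (INF y\<in>shrunk ?Z \<Delta>. norm (y - x))"
  proof (rule cINF_greatest[OF ne])
    fix y assume "y \<in> shrunk ?Z \<Delta>"
    then have y1: "\<And>m. p m + \<Delta> \<le> y $ m" and y2: "(\<Sum>m\<in>UNIV. w m * (y $ m - p m)) + \<Delta> * ?W \<le> 1"
      unfolding sh by blast+
    \<comment> \<open>Every other coordinate must rise by at least \<Delta>, which uses up budget
      and forces \<open>y\<close> back along axis \<open>k\<close> by
      \<open>\<Delta> * (2 * W * r - 1)\<close>.\<close>
    have "w k * (y $ k - p k) + \<Delta> * (?W - w k) \<le> (\<Sum>m\<in>UNIV. w m * (y $ m - p m))"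
    proof -
      have "\<Delta> * (?W - w k) = (\<Sum>m\<in>UNIV - {k}. w m * \<Delta>)"
        by (simp add: sum_diff1 algebra_simps sum_distrib_left)
      also have "\<dots> \<le> (\<Sum>m\<in>UNIV - {k}. w m * (y $ m - p m))"
        using y1 w by (intro sum_mono mult_left_mono) (simp_all add: le_diff_eq less_imp_le add.commute)
      finally show ?thesis by (simp add: sum.remove[of UNIV k])
    qed
    then have "w k * (y $ k - p k) \<le> 1 - 2 * \<Delta> * ?W + \<Delta> * w k" using y2 by (simp add: algebra_simps)
    then have yk: "y $ k - p k \<le> r - 2 * \<Delta> * ?W * r + \<Delta>" using w[of k] by (simp add: rk field_simps)
    have "\<Delta>\<^sup>2 * (?M - 1 + (2 * ?W * r - 1)\<^sup>2) = (\<Sum>m\<in>UNIV - {k}. \<Delta>\<^sup>2) + (\<Delta> * (2 * ?W * r - 1))\<^sup>2"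
      by (simp add: card_Diff_singleton of_nat_diff Suc_leI power_mult_distrib distrib_left mult.commute)
    also have "\<dots> \<le> (\<Sum>m\<in>UNIV - {k}. ((y - x) $ m)\<^sup>2) + ((y - x) $ k)\<^sup>2"
    proof (intro add_mono sum_mono)
      fix m assume "m \<in> UNIV - {k}"
      then show "\<Delta>\<^sup>2 \<le> ((y - x) $ m)\<^sup>2"
        using y1[of m] D by (intro power_mono) (simp_all add: x_def)
    next
      have "\<Delta> * (2 * ?W * r - 1) \<le> - ((y - x) $ k)" using yk by (simp add: x_def algebra_simps)
      moreover have "0 \<le> \<Delta> * (2 * ?W * r - 1)" using D r by simp
      ultimately show "(\<Delta> * (2 * ?W * r - 1))\<^sup>2 \<le> ((y - x) $ k)\<^sup>2"
        using power_mono[of "\<Delta> * (2 * ?W * r - 1)" "- ((y - x) $ k)" 2] by (simp only: power2_minus)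
    qed
    also have "\<dots> = (norm (y - x))\<^sup>2" unfolding norm_vec_power2 by (simp add: sum.remove[of UNIV k])
    finally have "(\<Delta> * sharp_const w)\<^sup>2 \<le> (norm (y - x))\<^sup>2" using M by (simp add: sc power_mult_distrib)
    then show "\<Delta> * sharp_const w \<le> norm (y - x)" by (rule power2_le_imp_le) simp
  qed
  then show ?thesis
    unfolding sharpness_def using x upper
    by (intro antisym cSUP_least cSUP_upper2[where x = x] bdd_aboveI2) auto
qed

section \<open>The sharpness factor: scaling, minimum and continuity\<close>

text \<open>Only the ratio of sum to minimum enters. This permits dividing the diverging weights by
  \<open>sqrt (ln T)\<close> before taking limits.\<close>

lemma sharp_const_scale:
  fixes w :: "'m::finite \<Rightarrow> real"
  assumes t: "t > 0"
  shows "sharp_const (\<lambda>m. t * w m) = sharp_const w"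
proof -
  have "Min ((\<lambda>x. t * x) ` range w) = t * Min (range w)"
    using t by (intro mono_Min_commute[symmetric]) (auto intro!: monoI)
  then have "Min (range (\<lambda>m. t * w m)) = t * Min (range w)" by (simp add: image_image)
  then show ?thesis using t by (simp add: sharp_const_def flip: sum_distrib_left)
qed

text \<open>The factor increases with the ratio of sum to minimum, which is at least M, and M - 1 +
  (2 M - 1)^2 = M (4 M - 3). If the ratio is M, the nonnegative excesses over the minimum sum to 0,
  so each vanishes.\<close>

lemma
  fixes w :: "'m::finite \<Rightarrow> real"
  assumes w: "\<And>m. w m > 0"
  shows sharp_const_ge: "sqrt (real CARD('m)) * sqrt (4 * real CARD('m) - 3) \<le> sharp_const w"
    and sharp_const_minimal_imp_constant: "sharp_const w \<le> sqrt (real CARD('m)) * sqrt (4 * real CARD('m) - 3) \<Longrightarrow> w m = Min (range w)"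
proof -
  let ?M = "real CARD('m)" and ?r = "sum w UNIV / Min (range w)"
  have mu: "Min (range w) > 0" using Min_range_pos[of w, OF w] .
  have M: "?M \<ge> 1" by (simp add: Suc_leI)
  have MM: "sqrt ?M * sqrt (4 * ?M - 3) = sqrt (?M - 1 + (2 * ?M - 1)\<^sup>2)"
    unfolding real_sqrt_mult[symmetric] by (simp add: power2_eq_square algebra_simps)
  have "?M * Min (range w) \<le> sum w UNIV" by (rule sum_bounded_below) simp
  then have r: "?M \<le> ?r" using mu by (simp add: field_simps)
  have iff: "a \<le> b" if "sqrt (?M - 1 + (2 * a - 1)\<^sup>2) \<le> sqrt (?M - 1 + (2 * b - 1)\<^sup>2)" "b \<ge> 1" for a b
    using that power2_le_imp_le[of "2 * a - 1" "2 * b - 1"] by simp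
  show "sqrt ?M * sqrt (4 * ?M - 3) \<le> sharp_const w"
    unfolding MM sharp_const_def times_divide_eq_right[symmetric] using r M
    by (intro real_sqrt_le_mono add_left_mono power_mono) linarith+
  assume "sharp_const w \<le> sqrt ?M * sqrt (4 * ?M - 3)"
  then have "?r \<le> ?M" unfolding MM sharp_const_def using iff[of ?r ?M] M by simp
  then have "sum w UNIV \<le> ?M * Min (range w)" using mu by (simp add: field_simps)
  then have "(\<Sum>m\<in>UNIV. w m - Min (range w)) \<le> 0" by (simp add: sum_subtractf)
  moreover have "w m - Min (range w) \<le> (\<Sum>m\<in>UNIV. w m - Min (range w))"
    by (intro member_le_sum) simp_all
  moreover have "Min (range w) \<le> w m" by simp
  ultimately show "w m = Min (range w)" by linarith
qed

lemma sharp_const_const: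
  fixes t :: real
  assumes "t > 0"
  shows "sharp_const (\<lambda>m::'m::finite. t) = sqrt (real CARD('m)) * sqrt (4 * real CARD('m) - 3)"
  using assms unfolding sharp_const_def real_sqrt_mult[symmetric]
  by (simp add: power2_eq_square algebra_simps)

lemma tendsto_Min_image:
  fixes f :: "'i \<Rightarrow> 'b \<Rightarrow> real"
  assumes "finite A" "A \<noteq> {}" "\<And>i. i \<in> A \<Longrightarrow> (f i \<longlongrightarrow> l i) F"
  shows "((\<lambda>x. Min ((\<lambda>i. f i x) ` A)) \<longlongrightarrow> Min (l ` A)) F"
  using assms
proof (induction rule: finite_ne_induct)
  case (insert i A)
  then have "((\<lambda>x. min (f i x) (Min ((\<lambda>i. f i x) ` A))) \<longlongrightarrow> min (l i) (Min (l ` A))) F"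
    by (intro tendsto_min) auto
  with insert.hyps show ?case by simp
qed simp

text \<open>Positive limits keep the minimum in the denominator away from 0.\<close>

lemma tendsto_sharp_const:
  fixes w :: "'b \<Rightarrow> 'm::finite \<Rightarrow> real"
  assumes lim: "\<And>m. ((\<lambda>x. w x m) \<longlongrightarrow> v m) F" and v: "\<And>m. v m > 0"
  shows "((\<lambda>x. sharp_const (w x)) \<longlongrightarrow> sharp_const v) F"
proof -
  have "((\<lambda>x. Min (range (w x))) \<longlongrightarrow> Min (range v)) F"
    using tendsto_Min_image[of UNIV "\<lambda>m x. w x m" v F] lim by simp
  then show ?thesis
    unfolding sharp_const_def using Min_range_pos[of v, OF v] lim
    by (intro tendsto_intros) (assumption | rule less_imp_neq[symmetric])+
qed


section \<open>Asymptotics of the regret bound\<close>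

text \<open>Makes the logarithm in \<open>beta\<close> nonnegative for every T, since \<delta> < 1/2
  < M.\<close>

lemma log_factor_ge_1:
  fixes \<nu> \<delta> :: real
  assumes "\<nu> > 0" "0 < \<delta>" "\<delta> < 1 / 2"
  shows "1 \<le> (1 + real T * K\<^sup>2 / \<nu>) / (\<delta> / real CARD('m::finite))"
proof -
  have "\<delta> \<le> real CARD('m)" using assms(3) Suc_leI[OF zero_less_card_finite[where 'a = 'm]] by linarith
  then have "\<delta> / real CARD('m) \<le> 1" by simp
  also have "1 \<le> 1 + real T * K\<^sup>2 / \<nu>" using assms by simp
  finally show ?thesis using assms(2) by (subst le_divide_eq_1_pos) simp_all
qed

text \<open>Strictness comes from \<open>S * sqrt \<nu>\<close>; the noise part is only
  nonnegative.\<close>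

lemma beta_pos:
  fixes a :: "real ^ 'm"
  assumes "S > 0" "\<nu> > 0" "0 < \<delta>" "\<delta> < 1 / 2"
  shows "beta K S \<nu> \<sigma> R \<delta> d T a m > 0"
  unfolding beta_def using assms log_factor_ge_1[OF assms(2-4), where 'm = 'm]
  by (intro add_nonneg_pos mult_nonneg_nonneg mult_pos_pos real_sqrt_ge_zero ln_ge_zero) simp_all

text \<open>At \<open>T' = t_h\<close> the depth \<Delta> equals the maximal shrinkage, and it
  decreases with \<open>T'\<close>. Hence the exact sharpness formula is valid for every T, not only
  in the limit.\<close>

lemma sharpness_scaled_simplex:
  fixes c a :: "real ^ 'm"
  assumes c: "\<And>m. c $ m > 0" and b: "\<And>m. beta K S \<nu> \<sigma> R \<delta> d T a m > 0"
    and lam: "lam > 0" and nu: "\<nu> > 0" and K: "K > 0"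
    and T': "T' \<ge> t_h K S \<nu> lam \<sigma> R \<delta> d c T a"
  defines "w \<equiv> \<lambda>m. beta K S \<nu> \<sigma> R \<delta> d T a m / c $ m"
    and "\<Delta> \<equiv> 2 * sqrt 2 * K / sqrt (2 * \<nu> + lam * T')"
  shows "max_shrinkage (scaled_simplex K S \<nu> \<sigma> R \<delta> d c T a) = 1 / (2 * sum w UNIV)"
    and "sharpness (scaled_simplex K S \<nu> \<sigma> R \<delta> d c T a) \<Delta> = \<Delta> * sharp_const w"
proof -
  have w: "w m > 0" for m using c b by (simp add: w_def)
  have W: "sum w UNIV > 0" using w by (intro sum_pos) auto
  note Z = scaled_simplex_eq_corner_simplex[of c K S \<nu> \<sigma> R \<delta> d T a, OF c b, folded w_def]
  show H: "max_shrinkage (scaled_simplex K S \<nu> \<sigma> R \<delta> d c T a) = 1 / (2 * sum w UNIV)"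
    unfolding Z by (rule max_shrinkage_corner_simplex[OF w])
  have "t_h K S \<nu> lam \<sigma> R \<delta> d c T a = (32 * K\<^sup>2 * (sum w UNIV)\<^sup>2 - 2 * \<nu>) / lam"
    unfolding t_h_def H using W lam by (simp add: field_simps power2_eq_square)
  then have le: "(4 * sqrt 2 * K * sum w UNIV)\<^sup>2 \<le> 2 * \<nu> + lam * T'"
    using mult_left_mono[OF T' less_imp_le[OF lam]] lam by (simp add: power_mult_distrib)
  then have "4 * sqrt 2 * K * sum w UNIV \<le> sqrt (2 * \<nu> + lam * T')" by (rule real_le_rsqrt)
  moreover have "0 < 4 * sqrt 2 * K * sum w UNIV" using W K by simp
  ultimately have "0 < sqrt (2 * \<nu> + lam * T')"
    and "2 * sqrt 2 * K * (2 * sum w UNIV) \<le> 1 * sqrt (2 * \<nu> + lam * T')" by linarith+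
  then have "\<Delta> \<le> 1 / (2 * sum w UNIV)" "0 \<le> \<Delta>"
    unfolding \<Delta>_def using W K by (simp_all only: pos_divide_le_eq pos_le_divide_eq times_divide_eq_left) simp_all
  then show "sharpness (scaled_simplex K S \<nu> \<sigma> R \<delta> d c T a) \<Delta> = \<Delta> * sharp_const w"
    unfolding Z by (intro sharpness_corner_simplex w)
qed

text \<open>Radii grow like \<open>s = sqrt (ln T)\<close>, exploration time like
  \<open>N = (s T) powr (2/3)\<close>, and \<Delta> decays like \<open>1 / sqrt N\<close>. The first
  two terms are thus of order \<open>N\<close>, the third of lower order. Positive \<open>g\<close>
  keeps the limiting weights positive.\<close>

lemma regret_const_eq:
  fixes c a :: "real ^ 'm"
  assumes d: "d \<ge> 1"
    and L: "L > 0" and K: "K > 0" and S: "S > 0" and nu: "\<nu> > 0" and lam: "lam > 0"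
    and \<delta>: "0 < \<delta>" "\<delta> < 1 / 2"
    and c: "\<And>m. c $ m > 0"
    and g0: "\<And>m. R\<^sup>2 + (a $ m)\<^sup>2 * \<sigma>\<^sup>2 > 0"
  defines "g \<equiv> \<lambda>m. sqrt (R\<^sup>2 + (a $ m)\<^sup>2 * \<sigma>\<^sup>2)"
  shows "regret_const L K S \<nu> lam \<sigma> R \<delta> d c a =
    ereal (2 * L * K * (Max (range g) * sqrt (real d)) powr (2 / 3) *
      (2 * S * sqrt (real CARD('m)) / lam + sharp_const (\<lambda>m. g m / c $ m)))"
proof -
  let ?M = "real CARD('m)"
  define b where "b = (\<lambda>T. beta K S \<nu> \<sigma> R \<delta> d T a)"
  define B where "B = (\<lambda>T. beta_max K S \<nu> \<sigma> R \<delta> d T a)"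
  define l where "l = (\<lambda>T::nat. sqrt (real d * ln ((1 + real T * K\<^sup>2 / \<nu>) / (\<delta> / ?M))))"
  define s where "s = (\<lambda>T::nat. sqrt (ln (real T)))"
  define N where "N = (\<lambda>T::nat. ((real T)\<^sup>2 * ln (real T)) powr (1 / 3))"
  define G where "G = Max (range g)"
  define \<gamma> where "\<gamma> = G * sqrt (real d)"
  define w where "w = (\<lambda>T m. b T m / c $ m)"
  define T' where "T' = (\<lambda>T. exploration_time K S \<nu> lam \<sigma> R \<delta> d c T a)"
  define Z where "Z = (\<lambda>T. scaled_simplex K S \<nu> \<sigma> R \<delta> d c T a)"
  define \<Delta> where "\<Delta> = (\<lambda>T. 2 * sqrt 2 * K / sqrt (2 * \<nu> + lam * T' T))"
  \<comment> \<open>The limit of \<open>T' / N\<close>.\<close>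
  define \<tau> where "\<tau> = 2 / lam * \<gamma> powr (2 / 3)"
  have M: "?M > 0" by simp
  have d0: "real d > 0" using d by simp
  have g: "g m > 0" for m using g0 by (simp add: g_def)
  have Gg: "g m \<le> G" for m by (simp add: G_def)
  have G: "G > 0" using g Gg less_le_trans by blast
  have \<gamma>: "\<gamma> > 0" using G d0 by (simp add: \<gamma>_def)
  have b0: "b T m > 0" for T m unfolding b_def using beta_pos[OF S nu \<delta>] .
  have b_eq: "b T m = g m * l T + S * sqrt \<nu>" for T m
    by (simp add: b_def beta_def g_def l_def)
  have T'_ge: "T' T \<ge> t_h K S \<nu> lam \<sigma> R \<delta> d c T a" for T
    by (simp add: T'_def exploration_time_def)
  have H: "max_shrinkage (Z T) = 1 / (2 * sum (w T) UNIV)"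
    and Sh: "sharpness (Z T) (\<Delta> T) = \<Delta> T * sharp_const (w T)" for T
    using sharpness_scaled_simplex[OF c b0[unfolded b_def] lam nu K T'_ge]
    by (simp_all add: Z_def \<Delta>_def w_def b_def)
  have w0: "w T m > 0" for T m using b0 c by (simp add: w_def)
  have W0: "sum (w T) UNIV > 0" for T using w0 by (intro sum_pos) auto

  have l_s: "(\<lambda>T. l T / s T) \<longlonglongrightarrow> sqrt (real d)"
    unfolding l_def s_def powr_half_sqrt[OF less_imp_le[OF d0], symmetric]
    using d0 \<delta>(1) nu K M by real_asymp
  have e_s: "(\<lambda>T. S * sqrt \<nu> / s T) \<longlonglongrightarrow> 0"
    unfolding s_def by real_asymp
  have one_s: "(\<lambda>T. 1 / s T) \<longlonglongrightarrow> 0"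
    unfolding s_def by real_asymp
  have s2_N: "(\<lambda>T. (s T)\<^sup>2 / N T) \<longlonglongrightarrow> 0"
    unfolding s_def N_def by real_asymp
  have one_N: "(\<lambda>T. 1 / N T) \<longlonglongrightarrow> 0"
    unfolding N_def by real_asymp
  have N_T: "(\<lambda>T. N T / real T) \<longlonglongrightarrow> 0"
    unfolding N_def by real_asymp
  \<comment> \<open>The square of the third regret term over \<open>N\<close> is this times
    convergent factors; it behaves like T (ln T)^2 / (T^2 ln T)^(2/3).\<close>
  have third: "(\<lambda>T. ln (1 + real T * K\<^sup>2 / (real d * \<nu>)) * (real T * (s T)\<^sup>2) / (N T)\<^sup>2) \<longlonglongrightarrow> 0"
    unfolding s_def N_def using d0 nu K by real_asymp

  have affine: "(\<lambda>T. (x * l T + S * sqrt \<nu>) / s T) \<longlonglongrightarrow> x * sqrt (real d)" for x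
    using tendsto_add[OF tendsto_mult_left[OF l_s, of x] e_s] by (simp add: add_divide_distrib)
  have b_s: "(\<lambda>T. b T m / s T) \<longlonglongrightarrow> g m * sqrt (real d)" for m
    unfolding b_eq by (rule affine)
  have l0: "l T \<ge> 0" for T
    unfolding l_def using log_factor_ge_1[OF nu \<delta>, where 'm = 'm]
    by (intro real_sqrt_ge_zero mult_nonneg_nonneg ln_ge_zero) simp_all
  \<comment> \<open>The radii are a monotone affine function of \<open>g\<close>, so the maximum
    passes through to \<open>G\<close>.\<close>
  have "B T = G * l T + S * sqrt \<nu>" for T
  proof -
    have "Max ((\<lambda>x. x * l T + S * sqrt \<nu>) ` range g) = G * l T + S * sqrt \<nu>"
      unfolding G_def using l0
      by (intro mono_Max_commute[symmetric]) (auto intro!: monoI mult_right_mono)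
    then show ?thesis by (simp add: B_def beta_max_def image_image b_eq[unfolded b_def])
  qed
  then have B_s: "(\<lambda>T. B T / s T) \<longlonglongrightarrow> \<gamma>"
    unfolding \<gamma>_def using affine[of G] by simp
  have B0: "B T > 0" for T
    using b0 by (auto simp: B_def beta_max_def b_def Max_gr_iff)
  have w_s: "(\<lambda>T. w T m / s T) \<longlonglongrightarrow> g m * sqrt (real d) / c $ m" for m
    using tendsto_divide[OF b_s tendsto_const, of "c $ m" m] c[of m]
    by (simp add: w_def divide_divide_eq_left mult.commute)
  have W_s: "(\<lambda>T. sum (w T) UNIV / s T) \<longlonglongrightarrow> (\<Sum>m\<in>UNIV. g m * sqrt (real d) / c $ m)" (is "_ \<longlonglongrightarrow> ?\<omega>")
    unfolding sum_divide_distrib by (intro tendsto_sum w_s)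
  have \<omega>: "?\<omega> > 0" using g d0 c by (intro sum_pos) auto

  \<comment> \<open>From T = 2 on ln T is positive, so the quotients by \<open>s\<close> and
    \<open>N\<close> are genuine.\<close>
  have ev: "eventually (\<lambda>T. s T > 0 \<and> N T > 0 \<and> real T > 0) sequentially"
    using eventually_ge_at_top[of 2] by eventually_elim (simp add: s_def N_def)
  have ev_N: "eventually (\<lambda>T. N T = (s T * real T) powr (2 / 3)) sequentially"
    using eventually_ge_at_top[of 2]
  proof eventually_elim
    case (elim T)
    then have "s T > 0" by (simp add: s_def)
    then have "(s T * real T) powr (2 / 3) = ((s T * real T)\<^sup>2) powr (1 / 3)"
      using elim by (simp add: powr_powr flip: powr_numeral)
    also have "(s T * real T)\<^sup>2 = (real T)\<^sup>2 * ln (real T)"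
      using elim by (simp add: power_mult_distrib s_def)
    finally show ?case by (simp add: N_def)
  qed
  \<comment> \<open>This turns the second term, of order \<open>s T / sqrt N\<close>, into order
    \<open>N\<close>.\<close>
  have ev_sT: "eventually (\<lambda>T. s T * real T = N T * sqrt (N T)) sequentially"
    using ev ev_N
  proof eventually_elim
    case (elim T)
    then have "s T * real T > 0" by simp
    then have "(s T * real T) powr (2 / 3 + 2 / 3 * (1 / 2)) = N T * sqrt (N T)"
      unfolding elim(2) by (simp only: powr_half_sqrt[OF powr_ge_zero, symmetric] powr_powr powr_add)
    then show ?case using \<open>s T * real T > 0\<close> by simp
  qed

  have "(\<lambda>T. (B T / s T) powr (2 / 3)) \<longlonglongrightarrow> \<gamma> powr (2 / 3)"
    using \<gamma> by (intro tendsto_powr B_s tendsto_const) simp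
  moreover have "eventually (\<lambda>T. (B T / s T) powr (2 / 3) = (B T * real T) powr (2 / 3) / N T) sequentially"
    using ev ev_N
  proof eventually_elim
    case (elim T)
    from elim(1) have s: "s T > 0" and N: "N T > 0" and T: "real T > 0" by simp_all
    have "B T * real T = B T / s T * (s T * real T)" using s by simp
    then have "(B T * real T) powr (2 / 3) = (B T / s T) powr (2 / 3) * N T"
      unfolding elim(2) using B0[of T] s T by (simp only: powr_mult less_imp_le)
    then show ?case using N by simp
  qed
  ultimately have X_N: "(\<lambda>T. (B T * real T) powr (2 / 3) / N T) \<longlonglongrightarrow> \<gamma> powr (2 / 3)"
    by (rule Lim_transform_eventually)
  \<comment> \<open>\<open>t_h\<close> grows only like W^2, that is like ln T, and is negligible
    against \<open>N\<close>.\<close>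
  have "(\<lambda>T. 32 * K\<^sup>2 / lam * ((sum (w T) UNIV / s T)\<^sup>2 * ((s T)\<^sup>2 / N T)) - 2 * \<nu> / lam * (1 / N T)) \<longlonglongrightarrow>
      32 * K\<^sup>2 / lam * (?\<omega>\<^sup>2 * 0) - 2 * \<nu> / lam * 0"
    by (intro tendsto_intros W_s s2_N one_N)
  moreover have "eventually (\<lambda>T. 32 * K\<^sup>2 / lam * ((sum (w T) UNIV / s T)\<^sup>2 * ((s T)\<^sup>2 / N T)) - 2 * \<nu> / lam * (1 / N T)
      = t_h K S \<nu> lam \<sigma> R \<delta> d c T a / N T) sequentially"
    using ev
  proof eventually_elim
    case (elim T)
    then have s: "s T > 0" and N: "N T > 0" by simp_all
    show ?case
      unfolding t_h_def H[unfolded Z_def] using W0[of T] lam s N by (simp add: field_simps power2_eq_square)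
  qed
  ultimately have th_N: "(\<lambda>T. t_h K S \<nu> lam \<sigma> R \<delta> d c T a / N T) \<longlonglongrightarrow> 0"
    by (force intro: Lim_transform_eventually)
  have td_N: "(\<lambda>T. t_delta K lam \<delta> d / N T) \<longlonglongrightarrow> 0"
    using tendsto_mult_left[OF one_N, of "t_delta K lam \<delta> d"] by simp
  \<comment> \<open>Of the three lower bounds on the exploration time only the last survives
    division by \<open>N\<close>.\<close>
  have "(\<lambda>T. max (t_h K S \<nu> lam \<sigma> R \<delta> d c T a / N T)
      (max (t_delta K lam \<delta> d / N T) (2 / lam * ((B T * real T) powr (2 / 3) / N T)))) \<longlonglongrightarrow> max 0 (max 0 \<tau>)"
    unfolding \<tau>_def by (intro tendsto_max th_N td_N tendsto_mult_left X_N)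
  moreover have "eventually (\<lambda>T. max (t_h K S \<nu> lam \<sigma> R \<delta> d c T a / N T)
      (max (t_delta K lam \<delta> d / N T) (2 / lam * ((B T * real T) powr (2 / 3) / N T))) = T' T / N T) sequentially"
    using ev
  proof eventually_elim
    case (elim T)
    then have "N T > 0" by simp
    then show ?case unfolding T'_def exploration_time_def B_def by (simp add: max_divide_distrib_right)
  qed
  ultimately have "(\<lambda>T. T' T / N T) \<longlonglongrightarrow> max 0 (max 0 \<tau>)"
    by (rule Lim_transform_eventually)
  moreover have "\<tau> > 0" using \<gamma> lam by (simp add: \<tau>_def)
  ultimately have \<tau>: "\<tau> > 0" and T'_N: "(\<lambda>T. T' T / N T) \<longlonglongrightarrow> \<tau>" by simp_all
  have "(\<lambda>T. T' T / N T * (N T / real T)) \<longlonglongrightarrow> \<tau> * 0" by (intro tendsto_mult T'_N N_T)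
  moreover have "eventually (\<lambda>T. T' T / N T * (N T / real T) = T' T / real T) sequentially"
    using ev by eventually_elim simp
  ultimately have T'_T: "(\<lambda>T. T' T / real T) \<longlonglongrightarrow> 0"
    by (force intro: Lim_transform_eventually)

  have "(\<lambda>T. sharp_const (\<lambda>m. w T m / s T)) \<longlonglongrightarrow> sharp_const (\<lambda>m. g m * sqrt (real d) / c $ m)"
    using g d0 c by (intro tendsto_sharp_const w_s) simp
  also have "sharp_const (\<lambda>m. g m * sqrt (real d) / c $ m) = sharp_const (\<lambda>m. g m / c $ m)"
    using sharp_const_scale[of "sqrt (real d)" "\<lambda>m. g m / c $ m"] d0 by (simp add: mult.commute)
  finally have \<kappa>: "(\<lambda>T. sharp_const (\<lambda>m. w T m / s T)) \<longlonglongrightarrow> sharp_const (\<lambda>m. g m / c $ m)" .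
  \<comment> \<open>The maximal shrinkage 1 / (2 W) tends to 0, so its maximum with 2 tends to
    2.\<close>
  have "(\<lambda>T. max (1 / (2 * (sum (w T) UNIV / s T)) * (1 / s T)) 2) \<longlonglongrightarrow> max (1 / (2 * ?\<omega>) * 0) 2"
    using \<omega> by (intro tendsto_intros W_s one_s) simp
  then have max2: "(\<lambda>T. max (1 / (2 * (sum (w T) UNIV / s T)) * (1 / s T)) 2) \<longlonglongrightarrow> 2" by simp

  have "(\<lambda>T. 2 * L * K * S * sqrt ?M * (T' T / N T)
      + L * (B T / s T) * (1 - T' T / real T) * (2 * sqrt 2 * K / sqrt (2 * \<nu> * (1 / N T) + lam * (T' T / N T)))
          * sharp_const (\<lambda>m. w T m / s T)
      + L * max (1 / (2 * (sum (w T) UNIV / s T)) * (1 / s T)) 2 *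
          sqrt (2 * real d * (1 - T' T / real T) * (\<Sum>m\<in>UNIV. (b T m / s T)\<^sup>2) *
            (ln (1 + real T * K\<^sup>2 / (real d * \<nu>)) * (real T * (s T)\<^sup>2) / (N T)\<^sup>2)))
    \<longlonglongrightarrow> 2 * L * K * S * sqrt ?M * \<tau>
      + L * \<gamma> * (1 - 0) * (2 * sqrt 2 * K / sqrt (2 * \<nu> * 0 + lam * \<tau>)) * sharp_const (\<lambda>m. g m / c $ m)
      + L * 2 * sqrt (2 * real d * (1 - 0) * (\<Sum>m\<in>UNIV. (g m * sqrt (real d))\<^sup>2) * 0)"
    (is "?f \<longlonglongrightarrow> ?v")
    using lam \<tau> by (intro tendsto_intros T'_N T'_T one_N B_s \<kappa> max2 b_s third) simp
  moreover have "eventually (\<lambda>T. ?f T = regret_bound L K S \<nu> lam \<sigma> R \<delta> d c T a / N T) sequentially"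
    using ev ev_sT
  proof eventually_elim
    case (elim T)
    from elim(1) have s: "s T > 0" and N: "N T > 0" and T: "real T > 0" by simp_all
    note sT = elim(2)
    have RB: "regret_bound L K S \<nu> lam \<sigma> R \<delta> d c T a = 2 * L * K * S * sqrt ?M * T' T
        + L * B T * (real T - T' T) * (\<Delta> T * sharp_const (w T))
        + L * max (1 / (2 * sum (w T) UNIV)) 2 *
            sqrt (2 * real d * ln (1 + real T * K\<^sup>2 / (real d * \<nu>)) * (real T - T' T) * (\<Sum>m\<in>UNIV. (b T m)\<^sup>2))"
      unfolding Sh[symmetric] H[symmetric]
      by (simp only: regret_bound_def Let_def T'_def B_def Z_def b_def \<Delta>_def)
    have \<Delta>: "2 * sqrt 2 * K / sqrt (2 * \<nu> * (1 / N T) + lam * (T' T / N T)) = \<Delta> T * sqrt (N T)"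
    proof -
      have "2 * \<nu> * (1 / N T) + lam * (T' T / N T) = (2 * \<nu> + lam * T' T) / N T"
        using N by (simp add: field_simps)
      then show ?thesis by (simp add: \<Delta>_def real_sqrt_divide)
    qed
    have \<kappa>: "sharp_const (\<lambda>m. w T m / s T) = sharp_const (w T)"
      using sharp_const_scale[of "1 / s T" "w T"] s by simp
    have "L * (B T / s T) * (1 - T' T / real T) * (\<Delta> T * sqrt (N T)) * sharp_const (w T)
      = L * B T * (real T - T' T) * (\<Delta> T * sharp_const (w T)) * (sqrt (N T) / (s T * real T))"
      using s T by (simp add: field_simps)
    also have "sqrt (N T) / (s T * real T) = 1 / N T" unfolding sT using N by simp
    finally have second: "L * (B T / s T) * (1 - T' T / real T) * (\<Delta> T * sqrt (N T)) * sharp_const (w T)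
      = L * B T * (real T - T' T) * (\<Delta> T * sharp_const (w T)) / N T" by simp
    have "2 * real d * (1 - T' T / real T) * (\<Sum>m\<in>UNIV. (b T m / s T)\<^sup>2) *
            (ln (1 + real T * K\<^sup>2 / (real d * \<nu>)) * (real T * (s T)\<^sup>2) / (N T)\<^sup>2)
      = 2 * real d * ln (1 + real T * K\<^sup>2 / (real d * \<nu>)) * (real T - T' T) * (\<Sum>m\<in>UNIV. (b T m)\<^sup>2) / (N T)\<^sup>2"
    proof -
      have "1 - T' T / real T = (real T - T' T) / real T" using T by (simp add: diff_divide_distrib)
      moreover have "(\<Sum>m\<in>UNIV. (b T m / s T)\<^sup>2) = (\<Sum>m\<in>UNIV. (b T m)\<^sup>2) / (s T)\<^sup>2"
        by (simp add: power_divide sum_divide_distrib)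
      ultimately show ?thesis using s T by simp
    qed
    then have third: "sqrt (2 * real d * (1 - T' T / real T) * (\<Sum>m\<in>UNIV. (b T m / s T)\<^sup>2) *
            (ln (1 + real T * K\<^sup>2 / (real d * \<nu>)) * (real T * (s T)\<^sup>2) / (N T)\<^sup>2))
      = sqrt (2 * real d * ln (1 + real T * K\<^sup>2 / (real d * \<nu>)) * (real T - T' T) * (\<Sum>m\<in>UNIV. (b T m)\<^sup>2)) / N T"
      using N by (simp add: real_sqrt_divide)
    have "1 / (2 * (sum (w T) UNIV / s T)) * (1 / s T) = 1 / (2 * sum (w T) UNIV)" using s by simp
    then show ?case unfolding RB \<Delta> \<kappa> second third by (simp add: add_divide_distrib)
  qed
  ultimately have "(\<lambda>T. regret_bound L K S \<nu> lam \<sigma> R \<delta> d c T a / N T) \<longlonglongrightarrow> ?v"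
    by (rule Lim_transform_eventually)
  also have "?v = 2 * L * K * \<gamma> powr (2 / 3) * (2 * S * sqrt ?M / lam + sharp_const (\<lambda>m. g m / c $ m))"
  proof -
    \<comment> \<open>With the cube root of \<gamma> all powers are integral; the second term
      becomes \<open>2 * L * K * e\<^sup>2\<close> times the sharpness factor.\<close>
    define e where "e = \<gamma> powr (1 / 3)"
    have e: "e > 0" using \<gamma> by (simp add: e_def)
    have e2: "\<gamma> powr (2 / 3) = e\<^sup>2" and e3: "\<gamma> = e ^ 3"
      using \<gamma> by (simp_all add: e_def powr_powr flip: powr_numeral)
    have "sqrt (lam * \<tau>) = sqrt 2 * e" using lam e by (simp add: \<tau>_def e2 real_sqrt_mult)
    then have "L * \<gamma> * (2 * sqrt 2 * K / sqrt (lam * \<tau>)) = 2 * L * K * e\<^sup>2"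
      using e by (simp add: e3 power2_eq_square power3_eq_cube)
    then show ?thesis using lam by (simp add: \<tau>_def e2 algebra_simps)
  qed
  finally have "(\<lambda>T. ereal (regret_bound L K S \<nu> lam \<sigma> R \<delta> d c T a / N T)) \<longlonglongrightarrow>
    ereal (2 * L * K * \<gamma> powr (2 / 3) * (2 * S * sqrt ?M / lam + sharp_const (\<lambda>m. g m / c $ m)))"
    by simp
  then show ?thesis
    unfolding regret_const_def N_def \<gamma>_def G_def by (rule limI)
qed

section \<open>Unimprovability of \<open>astar\<close>\<close>

theorem theorem3:
  fixes L K S \<nu> lam \<sigma> R \<delta> U ctilde rtilde :: real
    and d :: nat
    and c astar :: "real ^ 'm"
  assumes "d \<ge> 1"
    and "L > 0" and "K > 0" and "S > 0" and "\<nu> > 0" and "lam > 0" and "\<sigma> > 0"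
    and "R \<ge> 0" and "0 < \<delta>" and "\<delta> < 1 / 2"
    and "\<And>m. c $ m > 0"
    and "U > 0"
    and "ctilde = Max (range (\<lambda>m. c $ m))"
    and "U ^ 3 / (8 * L ^ 3 * K ^ 3 * real d * real CARD('m) powr (3 / 2) *
           (2 * S / lam + sqrt (4 * real CARD('m) - 3)) ^ 3) - R\<^sup>2 \<ge> 0"
    and "rtilde = 1 / \<sigma> *
           sqrt (U ^ 3 / (8 * L ^ 3 * K ^ 3 * real d * real CARD('m) powr (3 / 2) *
             (2 * S / lam + sqrt (4 * real CARD('m) - 3)) ^ 3) - R\<^sup>2)"
    and "\<And>m. (R\<^sup>2 / \<sigma>\<^sup>2 + rtilde\<^sup>2) * ((c $ m)\<^sup>2 / ctilde\<^sup>2) - R\<^sup>2 / \<sigma>\<^sup>2 \<ge> 0"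
    and "astar = (\<chi> m. sqrt ((R\<^sup>2 / \<sigma>\<^sup>2 + rtilde\<^sup>2) * ((c $ m)\<^sup>2 / ctilde\<^sup>2) - R\<^sup>2 / \<sigma>\<^sup>2))"
  shows "astar \<in> unimprovable L K S \<nu> lam \<sigma> R \<delta> d c U"
proof -
  let ?M = "real CARD('m)"
  note d = assms(1) and L = assms(2) and K = assms(3) and S = assms(4) and nu = assms(5)
    and lam = assms(6) and sig = assms(7) and delta = assms(9,10) and c = assms(11) and U = assms(12)
    and ctilde = assms(13) and Q0 = assms(14) and rtilde = assms(15) and nonneg = assms(16)
    and astar = assms(17)
  define E where "E = 2 * S / lam + sqrt (4 * ?M - 3)"
  \<comment> \<open>\<open>Q = R\<^sup>2 + \<sigma>\<^sup>2 * rtilde\<^sup>2\<close>, which turns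
    out to be the largest squared \<open>g\<close> at \<open>astar\<close>.\<close>
  define Q where "Q = U ^ 3 / (8 * L ^ 3 * K ^ 3 * real d * ?M powr (3 / 2) * E ^ 3)"
  define \<kappa> where "\<kappa> = sqrt ?M * sqrt (4 * ?M - 3)"
  define A where "A = 2 * S * sqrt ?M / lam"
  define g where "g = (\<lambda>(a :: real ^ 'm) m. sqrt (R\<^sup>2 + (a $ m)\<^sup>2 * \<sigma>\<^sup>2))"
  have M: "?M \<ge> 1" by (simp add: Suc_leI)
  have E: "E > 0" unfolding E_def using S lam M by (intro add_pos_nonneg real_sqrt_ge_zero divide_pos_pos) linarith+
  have \<kappa>0: "\<kappa> > 0"
    unfolding \<kappa>_def using M by (intro mult_pos_pos) (simp_all only: real_sqrt_gt_zero)
  have A0: "A > 0" using S lam by (simp add: A_def)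
  have AE: "A + \<kappa> = sqrt ?M * E" by (simp add: A_def \<kappa>_def E_def algebra_simps)
  have Q: "Q > 0" using U L K d E M by (simp add: Q_def)
  have r2: "rtilde\<^sup>2 = (Q - R\<^sup>2) / \<sigma>\<^sup>2"
    using Q0 by (simp add: rtilde Q_def E_def power_divide)
  have ct_le: "c $ m \<le> ctilde" for m by (simp add: ctilde)
  have ct: "ctilde > 0" using less_le_trans[OF c ct_le] .
  obtain k where k: "c $ k = ctilde" using Max_in[of "range (\<lambda>m. c $ m)"] by (fastforce simp: ctilde)
  have "R\<^sup>2 / \<sigma>\<^sup>2 + rtilde\<^sup>2 = Q / \<sigma>\<^sup>2" by (simp add: r2 diff_divide_distrib)
  then have as0: "astar $ m \<ge> 0"
    and as2: "(astar $ m)\<^sup>2 * \<sigma>\<^sup>2 = Q * ((c $ m)\<^sup>2 / ctilde\<^sup>2) - R\<^sup>2" for m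
    using nonneg[of m] sig by (simp_all add: astar left_diff_distrib)
  have gs: "g astar m = sqrt Q / ctilde * c $ m" for m
    using as2[of m] c[of m] ct by (simp add: g_def real_sqrt_mult real_sqrt_divide)
  have gs0: "g astar m > 0" for m using gs c ct Q by simp
  have Gs: "Max (range (g astar)) = sqrt Q"
  proof (rule Max_eqI)
    fix y assume "y \<in> range (g astar)"
    then obtain m where "y = sqrt Q * (c $ m / ctilde)" by (auto simp: gs)
    moreover have "c $ m / ctilde \<le> 1" using ct ct_le by simp
    ultimately show "y \<le> sqrt Q" using Q by (simp only: mult_left_le real_sqrt_ge_zero less_imp_le)
  next
    show "sqrt Q \<in> range (g astar)" by (rule range_eqI[of _ _ k]) (use gs[of k] k ct in simp)
  qed simp
  have const: "regret_const L K S \<nu> lam \<sigma> R \<delta> d c a =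
      ereal (2 * L * K * (Max (range (g a)) * sqrt (real d)) powr (2 / 3) *
        (A + sharp_const (\<lambda>m. g a m / c $ m)))" if "\<And>m. g a m > 0" for a
    unfolding A_def g_def using that
    by (intro regret_const_eq d L K S nu lam delta c) (simp add: g_def)
  define h where "h = (sqrt Q * sqrt (real d)) powr (2 / 3)"
  have h0: "h > 0" using Q d by (simp add: h_def)
  \<comment> \<open>Cubing removes the fractional powers, so the value at \<open>astar\<close> can
    be compared with \<open>U\<close> exactly.\<close>
  have "h ^ 3 = Q * real d"
  proof -
    have "h ^ 3 = (sqrt Q * sqrt (real d))\<^sup>2"
      using Q d by (simp add: h_def powr_powr flip: powr_numeral)
    then show ?thesis using Q by (simp add: power_mult_distrib)
  qed
  moreover have "sqrt ?M ^ 3 = ?M powr (3 / 2)"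
    by (simp add: powr_half_sqrt[symmetric] powr_powr flip: powr_numeral)
  ultimately have "(2 * L * K * h * (A + \<kappa>)) ^ 3 = 8 * L ^ 3 * K ^ 3 * (Q * real d) * (?M powr (3 / 2) * E ^ 3)"
    unfolding AE by (simp add: power_mult_distrib)
  also have "\<dots> = U ^ 3" using L K d M E by (simp add: Q_def)
  finally have Ueq: "2 * L * K * h * (A + \<kappa>) = U"
    by (rule power_eq_imp_eq_base) (use L K h0 A0 \<kappa>0 U in simp_all)
  have "sharp_const (\<lambda>m. g astar m / c $ m) = \<kappa>"
    using sharp_const_const[of "sqrt Q / ctilde", where 'm = 'm] c Q ct
    by (simp add: gs \<kappa>_def less_imp_neq[symmetric])
  then have in_A: "astar \<in> allowable L K S \<nu> lam \<sigma> R \<delta> d c U"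
    using as0 const[of astar] gs0 Ueq by (simp add: allowable_def Gs flip: h_def)
  have "astar + v = astar" if v: "\<And>m. 0 \<le> v $ m" and al: "astar + v \<in> allowable L K S \<nu> lam \<sigma> R \<delta> d c U" for v
  proof -
    define a where "a = astar + v"
    have a: "astar $ m \<le> a $ m" for m using v by (simp add: a_def)
    have ga: "g astar m \<le> g a m" for m
      unfolding g_def using a[of m] as0[of m] by (intro real_sqrt_le_mono add_left_mono mult_right_mono power_mono) auto
    then have ga0: "g a m > 0" for m using gs0[of m] less_le_trans by blast
    define G where "G = Max (range (g a))"
    define h' where "h' = (G * sqrt (real d)) powr (2 / 3)"
    let ?s = "sharp_const (\<lambda>m. g a m / c $ m)"
    have "sqrt Q = g astar k" using gs[of k] k ct by simp
    also have "\<dots> \<le> g a k" by (rule ga)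
    also have "\<dots> \<le> G" by (simp add: G_def)
    finally have QG: "sqrt Q \<le> G" .
    then have hh: "h \<le> h'" unfolding h_def h'_def using Q by (intro powr_mono2 mult_right_mono) auto
    have w0: "g a m / c $ m > 0" for m using ga0 c by simp
    \<comment> \<open>A product of two factors, neither smaller than at \<open>astar\<close>, must
      not exceed its value there; as all factors are positive, both are unchanged.\<close>
    have "2 * L * K * h' * (A + ?s) \<le> 2 * L * K * h * (A + \<kappa>)"
      using al const[of a] ga0 by (simp add: allowable_def Ueq a_def[symmetric] G_def[symmetric] h'_def[symmetric])
    then have le: "h' * (A + ?s) \<le> h * (A + \<kappa>)" using L K by (simp add: mult.assoc)
    have s\<kappa>: "\<kappa> \<le> ?s" unfolding \<kappa>_def by (rule sharp_const_ge[OF w0])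
    have "h * (A + ?s) \<le> h' * (A + ?s)" using hh A0 s\<kappa> \<kappa>0 by (intro mult_right_mono) auto
    then have "h * (A + ?s) \<le> h * (A + \<kappa>)" using le by simp
    then have "?s \<le> \<kappa>" using h0 by simp
    then have ratio: "g a m / c $ m = Min (range (\<lambda>m. g a m / c $ m))" for m
      unfolding \<kappa>_def by (rule sharp_const_minimal_imp_constant[OF w0])
    have "h' * (A + \<kappa>) \<le> h' * (A + ?s)" using s\<kappa> h0 hh by (intro mult_left_mono) auto
    then have "h' * (A + \<kappa>) \<le> h * (A + \<kappa>)" using le by simp
    then have "h' \<le> h" using A0 \<kappa>0 by simp
    have GQ: "G \<le> sqrt Q"
    proof (rule ccontr)
      assume "\<not> G \<le> sqrt Q"
      then have "h < h'" unfolding h_def h'_def using Q d by (intro powr_less_mono2) auto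
      then show False using \<open>h' \<le> h\<close> by simp
    qed
    have "a $ m \<le> astar $ m" for m
    proof -
      \<comment> \<open>Proportionality to \<open>c\<close> reduces every entry to index
        \<open>k\<close>, where \<open>g\<close> is at most \<open>sqrt Q\<close>.\<close>
      have "g a m / c $ m = g a k / ctilde" using ratio[of m] ratio[of k] k by simp
      also have "\<dots> \<le> sqrt Q / ctilde"
        using GQ ct Max_ge[of "range (g a)" "g a k"] by (intro divide_right_mono) (auto simp: G_def)
      finally have "g a m \<le> g astar m" using c[of m] by (simp add: gs pos_divide_le_eq)
      then have "(a $ m)\<^sup>2 \<le> (astar $ m)\<^sup>2" using sig by (simp add: g_def)
      then show ?thesis using as0 by (rule power2_le_imp_le)
    qed
    then have "a = astar" using a by (simp add: vec_eq_iff eq_iff)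
    then show ?thesis by (simp add: a_def)
  qed
  moreover have "astar \<in> {astar + v | v. \<forall>m. 0 \<le> v $ m}" by (force intro: exI[of _ 0])
  ultimately show ?thesis using in_A unfolding unimprovable_def by auto
qed

end
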